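(* Let $K$ and $L$ be compact Hausdorff spaces and let $T:C(K)\to C(L)$ be a positive isomorphic embedding. Let $p$ be the least integer such that $2^p>\|T\|\cdot\|T^{-1}\|$. Then there is a sequence \[K_1=K\supseteq K_2\supseteq\ldots\supseteq K_p\] of closed subspaces of $K$ such that (a) $K_p\in ci(L)$; (b) for every $i\le p-1$ and every $x\in K_i\setminus K_{i+1}$ there is an open set $U\subseteq K$ containing $x$ such that $\overline{U}\cap K_i\in ci(L)$.
   Context: $C(K)$ is the Banach space of real-valued continuous functions on $K$ with the supremum norm. An isomorphic embedding $T:C(K)\to C(L)$ is a linear operator (not necessarily surjective) for which there are constants $m_1,m_2>0$ with $m_1\|g\|\le\|Tg\|\le m_2\|g\|$ for all $g\in C(K)$; $\|T^{-1}\|$ is the norm of the inverse operator $T^{-1}:T[C(K)]\to C(K)$ defined on the range of $T$. $T$ is positive if $g\ge 0$ implies $Tg\ge 0$. For a compact space $L$, $ci(L)$ denotes the class of compact spaces that are continuous images of closed subspaces of $L$ (the empty subspace being allowed). *)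

theory Defs
  imports "HOL-Analysis.Analysis"
begin

text \<open>For a compact space (the type \<open>'k\<close> with \<open>compact UNIV\<close>), every continuous real function is
  bounded, so \<open>'k \<Rightarrow>\<^sub>C real\<close> with its library norm is the Banach space \<open>C(K)\<close>.\<close>

definition isomorphic_embedding ::
    "('a::real_normed_vector \<Rightarrow> 'b::real_normed_vector) \<Rightarrow> bool" where
  "isomorphic_embedding T \<longleftrightarrow>
     linear T \<and>
     (\<exists>m1 m2. m1 > 0 \<and> m2 > 0 \<and> (\<forall>g. m1 * norm g \<le> norm (T g) \<and> norm (T g) \<le> m2 * norm g))"

definition positive_operator ::
    "(('k::topological_space \<Rightarrow>\<^sub>C real) \<Rightarrow> ('l::topological_space \<Rightarrow>\<^sub>C real)) \<Rightarrow> bool" where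
  "positive_operator T \<longleftrightarrow>
     (\<forall>g. (\<forall>x. 0 \<le> apply_bcontfun g x) \<longrightarrow> (\<forall>y. 0 \<le> apply_bcontfun (T g) y))"

text \<open>The analogue of \<^const>\<open>onorm\<close> for an operator defined only on a subspace \<open>V\<close>; as there,
  the quotient at \<open>0\<close> is \<open>0 / 0 = 0\<close>.\<close>

definition onorm_on :: "'a::real_normed_vector set \<Rightarrow> ('a \<Rightarrow> 'b::real_normed_vector) \<Rightarrow> real" where
  "onorm_on V S = (SUP h\<in>V. norm (S h) / norm h)"

text \<open>The norm of the inverse operator, defined on the range of an injective \<open>T\<close>.\<close>

definition inverse_onorm :: "('a::real_normed_vector \<Rightarrow> 'b::real_normed_vector) \<Rightarrow> real" where
  "inverse_onorm T = onorm_on (range T) (inv T)"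

text \<open>The members of the class \<open>ci(L)\<close> that are subspaces of an ambient space \<open>'k\<close>. Here \<open>F\<close> may be
  empty, so \<open>{}\<close> is a member.\<close>

definition ci :: "'l::topological_space set \<Rightarrow> 'k::topological_space set set" where
  "ci L = {X. compact X \<and>
     (\<exists>F f. closedin (top_of_set L) F \<and> continuous_on F f \<and> f ` F = X)}"

end

theory Submission
  imports Defs
begin

text \<open>
  For \<open>y\<close> in \<open>L\<close> the positive functional \<open>g \<mapsto> T g y\<close> is integration against a measure
  \<open>\<nu>\<^sub>y\<close> on \<open>K\<close> of total mass at most \<open>\<parallel>T\<parallel>\<close>. The argument looks only at the atoms of these
  measures, and an atom can be recognised without any measure theory: \<open>\<nu>\<^sub>y {x} \<ge> r\<close> says exactly that
  \<open>T g y \<ge> r * g x\<close> for all \<open>g \<ge> 0\<close>. Being an intersection of closed conditions, this is a closed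
  relation between \<open>y\<close> and \<open>x\<close>.

  Put \<open>m = 1 / \<parallel>T\<^sup>-\<^sup>1\<parallel>\<close>. Testing \<open>T\<close> on functions of norm one which peak at \<open>x\<close>, and using that
  \<open>L\<close> is compact, one finds for each \<open>x\<close> some \<open>y\<close> with an atom of mass at least \<open>m\<close> at \<open>x\<close>
  (\<open>atom_if_peaks\<close>). Suppose now that all points of a closed set \<open>X\<close> are atoms of mass at least \<open>r\<close> of
  some \<open>\<nu>\<^sub>y\<close>. If no \<open>y\<close> carries two such atoms, then sending \<open>y\<close> to its atom is a continuous map
  from a closed subset of \<open>L\<close> onto \<open>X\<close>, so \<open>X\<close> is in \<open>ci L\<close> (\<open>in_ci_if_single_atoms\<close>). Consequently,
  if \<open>x\<close> has no neighbourhood in \<open>X\<close> belonging to \<open>ci L\<close>, then arbitrarily close to \<open>x\<close> there are two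
  atoms of mass \<open>r\<close> of one and the same measure; in the limit they merge into an atom of mass
  \<open>2 * r\<close> at \<open>x\<close> (\<open>atom_doubling\<close>).

  Let therefore \<open>K\<^sub>i\<^sub>+\<^sub>1\<close> consist of the points of \<open>K\<^sub>i\<close> that have no neighbourhood in \<open>K\<^sub>i\<close> belonging to
  \<open>ci L\<close>. This gives (b) by construction, and each point of \<open>K\<^sub>p\<close> is an atom of mass at least
  \<open>2\<^sup>p\<^sup>-\<^sup>1 * m\<close>. As \<open>2\<^sup>p * m > \<parallel>T\<parallel>\<close>, no \<open>\<nu>\<^sub>y\<close> has room for two of those, which gives (a).
\<close>

section \<open>Continuous functions on a compact Hausdorff space\<close>

lemma apply_Bcontfun_compact:
  fixes f :: "'a::topological_space \<Rightarrow> real"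
  assumes "compact (UNIV :: 'a set)" "continuous_on UNIV f"
  shows "apply_bcontfun (Bcontfun f) = f"
  using assms
  by (intro Bcontfun_inverse) (auto simp: bcontfun_def intro: compact_imp_bounded compact_continuous_image)

lemma ex_bcontfun_separating_points:
  fixes a b :: "'a::t2_space"
  assumes K: "compact (UNIV :: 'a set)" and "a \<noteq> b"
  obtains u :: "'a \<Rightarrow>\<^sub>C real" where "\<And>z. 0 \<le> u z" "\<And>z. u z \<le> 1" "u a = 1" "u b = 0"
proof -
  have "Hausdorff_space (euclidean :: 'a topology)"
    unfolding Hausdorff_space_def disjnt_def by (metis hausdorff open_openin)
  then have "normal_space (euclidean :: 'a topology)"
    using K by (intro compact_Hausdorff_or_regular_imp_normal_space) (auto simp: compact_space_def)
  then obtain f where f: "continuous_map (euclidean :: 'a topology) (top_of_set {0..1::real}) f"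
      "f ` {b} \<subseteq> {0}" "f ` {a} \<subseteq> {1}"
    using \<open>a \<noteq> b\<close> by (elim Urysohn_lemma[of _ "{b}" "{a}" 0 1]) auto
  from f(1) have cont: "continuous_on UNIV f" and range: "f z \<in> {0..1}" for z
    by (auto simp: continuous_map_in_subtopology)
  show ?thesis
    using that[of "Bcontfun f"] f(2,3) range by (auto simp: apply_Bcontfun_compact[OF K cont])
qed

lemma norm_const_bcontfun_one: "norm (const_bcontfun 1 :: 'a::topological_space \<Rightarrow>\<^sub>C real) = 1"
  using norm_bounded[of "const_bcontfun 1 :: 'a \<Rightarrow>\<^sub>C real" undefined]
    norm_bound[of "const_bcontfun 1 :: 'a \<Rightarrow>\<^sub>C real" 1]
  by simp

section \<open>The norm of the inverse\<close>

lemma norm_le_inverse_onorm: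
  assumes "isomorphic_embedding T"
  shows "norm g \<le> inverse_onorm T * norm (T g)"
proof -
  from assms obtain m where T: "linear T" and m: "m > 0" "\<And>g. m * norm g \<le> norm (T g)"
    unfolding isomorphic_embedding_def by blast
  have T0: "g = 0" if "T g = 0" for g
    using m(2)[of g] m(1) that by (simp add: mult_le_0_iff)
  then have inv: "inv T (T g) = g" for g
    by (simp add: T linear_injective_0 inv_f_f)
  have quot: "norm g / norm (T g) \<le> 1 / m" for g
  proof (cases "g = 0")
    case False
    then have "norm (T g) > 0" using T0 by auto
    then show ?thesis using m by (simp add: field_simps)
  qed (use m(1) in simp)
  have "norm (inv T (T g)) / norm (T g) \<le> inverse_onorm T"
    unfolding inverse_onorm_def onorm_on_def
    by (rule cSUP_upper) (auto intro!: bdd_aboveI[of _ "1 / m"] simp: inv quot)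
  then show ?thesis
    using T0[of g] by (cases "g = 0") (force simp: inv pos_divide_le_eq)+
qed

section \<open>Atoms\<close>

locale positive_operator_compact =
  fixes T :: "('k::t2_space \<Rightarrow>\<^sub>C real) \<Rightarrow> ('l::t2_space \<Rightarrow>\<^sub>C real)"
  assumes compact_domain: "compact (UNIV :: 'k set)"
    and compact_codomain: "compact (UNIV :: 'l set)"
    and linear: "linear T"
    and positive: "positive_operator T"
begin

lemma T_mono: "T f y \<le> T g y" if "\<And>z. apply_bcontfun f z \<le> apply_bcontfun g z"
proof -
  have "0 \<le> T (g - f) y"
    using positive that unfolding positive_operator_def by simp
  then show ?thesis by (simp add: linear_diff[OF linear])
qed

text \<open>In terms of the measure \<open>\<nu>\<^sub>y\<close> representing \<open>g \<mapsto> T g y\<close>, this says \<open>\<nu>\<^sub>y {x} \<ge> r\<close>.\<close>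

definition atom :: "real \<Rightarrow> 'l \<Rightarrow> 'k \<Rightarrow> bool" where
  "atom r y x \<longleftrightarrow> (\<forall>g. (\<forall>z. 0 \<le> apply_bcontfun g z) \<longrightarrow> r * g x \<le> T g y)"

text \<open>The atom relation is closed, and projecting along the compact space \<open>K\<close> preserves closedness.\<close>

lemma closed_atom_locations:
  assumes "closed C"
  shows "closed {y. \<exists>x\<in>C. atom r y x}"
proof -
  have "{q. snd q \<in> C \<and> atom r (fst q) (snd q)} =
      snd -` C \<inter> (\<Inter>g\<in>{g. \<forall>z. 0 \<le> apply_bcontfun g z}. {q. r * apply_bcontfun g (snd q) \<le> T g (fst q)})"
    by (auto simp: atom_def)
  moreover have "closed {q. r * apply_bcontfun g (snd q) \<le> T g (fst q)}" for g
    by (intro closed_Collect_le continuous_intros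
        continuous_on_compose2[OF continuous_on_apply_bcontfun[of UNIV]]) auto
  ultimately have "closed {q. snd q \<in> C \<and> atom r (fst q) (snd q)}"
    using assms by (auto intro!: closed_Int closed_INT closed_vimage_snd)
  moreover have "compact (UNIV :: ('l \<times> 'k) set)"
    using compact_Times[OF compact_codomain compact_domain] by simp
  ultimately have "compact (fst ` {q. snd q \<in> C \<and> atom r (fst q) (snd q)})"
    by (intro compact_continuous_image continuous_intros) (metis compact_Int_closed inf_top_left)
  moreover have "fst ` {q. snd q \<in> C \<and> atom r (fst q) (snd q)} = {y. \<exists>x\<in>C. atom r y x}"
    by (auto simp: image_iff)
  ultimately show ?thesis by (simp add: compact_imp_closed)
qed

text \<open>Two atoms of one measure add up: a function separating them splits \<open>g\<close> into a part that
  vanishes at \<open>b\<close> and one that vanishes at \<open>a\<close>.\<close>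

lemma two_atoms_add:
  assumes "atom r y a" "atom s y b" "a \<noteq> b" and g: "\<And>z. 0 \<le> apply_bcontfun g z"
  shows "r * g a + s * g b \<le> T g y"
proof -
  obtain u :: "'k \<Rightarrow>\<^sub>C real" where u: "\<And>z. 0 \<le> u z" "\<And>z. u z \<le> 1" "u a = 1" "u b = 0"
    using ex_bcontfun_separating_points[OF compact_domain \<open>a \<noteq> b\<close>] by blast
  define h where "h = Bcontfun (\<lambda>z. g z * u z)"
  have h: "apply_bcontfun h = (\<lambda>z. g z * u z)"
    unfolding h_def by (intro apply_Bcontfun_compact compact_domain continuous_intros) auto
  have "r * h a \<le> T h y"
    using assms(1) g u(1) unfolding atom_def by (metis (no_types, lifting) h mult_nonneg_nonneg)
  moreover have "\<forall>z. 0 \<le> (g - h) z"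
    using g u(2) by (simp add: h mult_left_le)
  then have "s * (g - h) b \<le> T (g - h) y"
    using assms(2) unfolding atom_def by blast
  ultimately show ?thesis
    by (simp add: h u linear_diff[OF linear])
qed

definition peak :: "'k \<Rightarrow> ('k \<Rightarrow>\<^sub>C real) \<Rightarrow> bool" where
  "peak x h \<longleftrightarrow> (\<forall>z. 0 \<le> h z \<and> h z \<le> 1) \<and> h x = 1"

lemma peak_const: "peak x (const_bcontfun 1)"
  by (simp add: peak_def)

lemma ex_peak_below:
  assumes "finite B" "\<And>h. h \<in> B \<Longrightarrow> peak x h"
  shows "\<exists>h0. peak x h0 \<and> (\<forall>h\<in>B. \<forall>z. h0 z \<le> apply_bcontfun h z)"
  using assms
proof (induction B rule: finite_induct)
  case empty
  then show ?case using peak_const by blast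
next
  case (insert f B)
  then obtain h0 where h0: "peak x h0" "\<forall>h\<in>B. \<forall>z. h0 z \<le> apply_bcontfun h z"
    by auto
  have min: "apply_bcontfun (Bcontfun (\<lambda>z. min (f z) (h0 z))) = (\<lambda>z. min (f z) (h0 z))"
    by (intro apply_Bcontfun_compact compact_domain continuous_intros) auto
  show ?case
    using h0 insert.prems[of f]
    by (intro exI[of _ "Bcontfun (\<lambda>z. min (f z) (h0 z))"])
      (auto simp: min peak_def min_le_iff_disj)
qed

text \<open>Each peak function may have its own witness \<open>y\<close>. Peak functions at \<open>x\<close> are directed downwards,
  so compactness of \<open>L\<close> provides a common one, and every \<open>g \<ge> 0\<close> with \<open>g x > 0\<close> lies above \<open>g x\<close>
  times a peak function.\<close>

lemma atom_if_peaks: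
  assumes "\<And>h. peak x h \<Longrightarrow> \<exists>y. c \<le> T h y"
  shows "\<exists>y. atom c y x"
proof -
  define A where "A h = {y. c \<le> T h y}" for h
  have "UNIV \<inter> \<Inter> (A ` Collect (peak x)) \<noteq> {}"
  proof (rule compact_imp_fip[OF compact_codomain])
    fix S assume "S \<in> A ` Collect (peak x)"
    then show "closed S"
      by (auto simp: A_def intro!: closed_Collect_le continuous_intros)
  next
    fix F assume "finite F" "F \<subseteq> A ` Collect (peak x)"
    then obtain B where B: "B \<subseteq> Collect (peak x)" "finite B" "F = A ` B"
      by (meson finite_subset_image)
    then obtain h0 where h0: "peak x h0" "\<forall>h\<in>B. \<forall>z. h0 z \<le> apply_bcontfun h z"
      using ex_peak_below[of B x] by auto
    then obtain y where y: "c \<le> T h0 y" using assms by blast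
    have "c \<le> T h y" if "h \<in> B" for h
      using T_mono[of h0 h y] h0 that y by fastforce
    then show "UNIV \<inter> \<Inter> F \<noteq> {}"
      using B(3) by (auto simp: A_def)
  qed
  then obtain y where y: "\<And>h. peak x h \<Longrightarrow> c \<le> T h y"
    by (auto simp: A_def)
  have "c * g x \<le> T g y" if g: "\<forall>z. 0 \<le> apply_bcontfun g z" for g
  proof (cases "g x = 0")
    case True
    then show ?thesis using g positive by (simp add: positive_operator_def)
  next
    case False
    then have pos: "g x > 0" using g by (simp add: less_le)
    define h where "h = Bcontfun (\<lambda>z. min 1 (g z / g x))"
    have h: "apply_bcontfun h = (\<lambda>z. min 1 (g z / g x))"
      unfolding h_def using False
      by (intro apply_Bcontfun_compact compact_domain continuous_intros) auto
    have "peak x h" using g pos by (auto simp: peak_def h)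
    then have "c * g x \<le> g x * T h y" using y pos by (simp add: mult.commute)
    also have "\<dots> = T (g x *\<^sub>R h) y" by (simp add: linear_scale[OF linear])
    also have "\<dots> \<le> T g y"
      using pos by (intro T_mono) (auto simp: h min_def field_simps)
    finally show ?thesis .
  qed
  then show ?thesis by (auto simp: atom_def)
qed

section \<open>Continuous images and doubling of atoms\<close>

text \<open>The map sending \<open>y\<close> to its unique atom in \<open>X\<close> is continuous because the preimage of a closed
  set is again a set of locations of atoms.\<close>

lemma in_ci_if_single_atoms:
  assumes X: "closed X" and cover: "\<And>x. x \<in> X \<Longrightarrow> \<exists>y. atom r y x"
    and single: "\<And>y a b. a \<in> X \<Longrightarrow> b \<in> X \<Longrightarrow> atom r y a \<Longrightarrow> atom r y b \<Longrightarrow> a = b"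
  shows "X \<in> ci (UNIV :: 'l set)"
proof -
  define F where "F = {y. \<exists>x\<in>X. atom r y x}"
  define f where "f y = (THE x. x \<in> X \<and> atom r y x)" for y
  have f_eq: "f y = x" if "x \<in> X" "atom r y x" for x y
    unfolding f_def using that single by blast
  have F: "closed F" unfolding F_def by (rule closed_atom_locations[OF X])
  have "closed (f -` C \<inter> F)" if "closed C" for C
  proof -
    have "f -` C \<inter> F = {y. \<exists>x\<in>C \<inter> X. atom r y x}"
      using f_eq by (auto simp: F_def)
    then show ?thesis using closed_atom_locations that X by (simp add: closed_Int)
  qed
  then have "continuous_on F f"
    using F by (simp add: continuous_on_closed_vimage)
  moreover have "f ` F = X"
    using cover f_eq by (force simp: F_def)
  moreover have "compact X"
    using compact_Int_closed[OF compact_domain X] by simp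
  moreover have "closedin (top_of_set UNIV) F"
    using F by simp
  ultimately show ?thesis unfolding ci_def by blast
qed

definition ci_derivative :: "'k set \<Rightarrow> 'k set" where
  "ci_derivative X =
     {x \<in> X. \<not> (\<exists>U. open U \<and> x \<in> U \<and> closure U \<inter> X \<in> ci (UNIV :: 'l set))}"

lemma closed_ci_derivative: "closed X \<Longrightarrow> closed (ci_derivative X)"
proof -
  assume "closed X"
  moreover have "ci_derivative X =
      X - \<Union> {U. open U \<and> closure U \<inter> X \<in> ci (UNIV :: 'l set)}"
    by (auto simp: ci_derivative_def)
  ultimately show ?thesis by (auto intro!: closed_Diff open_Union)
qed

text \<open>Let \<open>h\<close> peak at \<open>x\<close> and let \<open>t < 1\<close>. The set where \<open>h > t\<close> is a neighbourhood of \<open>x\<close>,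
  whose closure contains two atoms of mass \<open>r\<close> of a common measure; hence \<open>T h\<close> takes a value of at
  least \<open>2 * r * t\<close>.\<close>

lemma atom_doubling:
  assumes X: "closed X" and cover: "\<And>x. x \<in> X \<Longrightarrow> \<exists>y. atom r y x" and r: "r > 0"
    and x: "x \<in> ci_derivative X"
  shows "\<exists>y. atom (2 * r) y x"
proof (rule atom_if_peaks)
  fix h assume h: "peak x h"
  have "\<exists>y0\<in>UNIV. \<forall>y\<in>UNIV. T h y \<le> T h y0"
    by (intro continuous_attains_sup compact_codomain) auto
  then obtain y0 where y0: "\<And>y. T h y \<le> T h y0" by auto
  have "2 * r \<le> T h y0"
  proof (rule field_le_mult_one_interval)
    fix t :: real assume t: "0 < t" "t < 1"
    define U where "U = {z. t < h z}"
    have "open U"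
      unfolding U_def by (intro open_Collect_less continuous_intros) auto
    moreover have "x \<in> U" using h t by (simp add: U_def peak_def)
    ultimately have "closure U \<inter> X \<notin> ci (UNIV :: 'l set)"
      using x by (auto simp: ci_derivative_def)
    then obtain y a b where ab: "a \<in> closure U \<inter> X" "b \<in> closure U \<inter> X"
        "atom r y a" "atom r y b" "a \<noteq> b"
      using in_ci_if_single_atoms[of "closure U \<inter> X" r] cover X by blast
    have "closure U \<subseteq> {z. t \<le> h z}"
      by (intro closure_minimal closed_Collect_le continuous_intros) (auto simp: U_def)
    then have "t \<le> h a" "t \<le> h b" using ab(1,2) by auto
    then have "r * t + r * t \<le> r * h a + r * h b"
      using r by (intro add_mono mult_left_mono) auto
    also have "\<dots> \<le> T h y"
      using ab h by (intro two_atoms_add) (auto simp: peak_def)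
    also have "\<dots> \<le> T h y0" by (rule y0)
    finally show "t * (2 * r) \<le> T h y0" by (simp add: algebra_simps)
  qed
  then show "\<exists>y. 2 * r \<le> T h y" ..
qed

lemma closed_iterated_derivative: "closed ((ci_derivative ^^ n) UNIV)"
  by (induction n) (auto intro: closed_ci_derivative)

lemma atom_in_iterated_derivative:
  assumes cover: "\<And>x. \<exists>y. atom m y x" and m: "m > 0"
    and x: "x \<in> (ci_derivative ^^ n) UNIV"
  shows "\<exists>y. atom (2 ^ n * m) y x"
  using x
proof (induction n arbitrary: x)
  case 0
  then show ?case using cover by simp
next
  case (Suc n)
  then show ?case
    using atom_doubling[OF closed_iterated_derivative[of n], of "2 ^ n * m" x] m
    by (simp add: mult.assoc)
qed

text \<open>Two atoms of mass \<open>2 ^ n * m\<close> would already exceed the total mass \<open>T 1 y\<close>.\<close>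

lemma iterated_derivative_in_ci:
  assumes cover: "\<And>x. \<exists>y. atom m y x" and m: "m > 0"
    and mass: "\<And>y. T (const_bcontfun 1) y < 2 * (2 ^ n * m)"
  shows "(ci_derivative ^^ n) UNIV \<in> ci (UNIV :: 'l set)"
proof (rule in_ci_if_single_atoms[OF closed_iterated_derivative])
  show "\<exists>y. atom (2 ^ n * m) y x" if "x \<in> (ci_derivative ^^ n) UNIV" for x
    using atom_in_iterated_derivative[OF cover m that] .
  fix y a b assume "atom (2 ^ n * m) y a" "atom (2 ^ n * m) y b"
  then have "2 ^ n * m + 2 ^ n * m \<le> T (const_bcontfun 1) y" if "a \<noteq> b"
    using two_atoms_add[of "2 ^ n * m" y a "2 ^ n * m" b "const_bcontfun 1"] that by simp
  then show "a = b"
    using mass[of y] by fastforce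
qed

end

section \<open>The filtration\<close>

theorem theorem4p4:
  fixes T :: "('k::t2_space \<Rightarrow>\<^sub>C real) \<Rightarrow> ('l::t2_space \<Rightarrow>\<^sub>C real)"
    and p :: int
  assumes "compact (UNIV :: 'k set)"
    and "compact (UNIV :: 'l set)"
    and "isomorphic_embedding T"
    and "positive_operator T"
    and "2 powi p > onorm T * inverse_onorm T"
    and "\<And>q::int. 2 powi q > onorm T * inverse_onorm T \<Longrightarrow> p \<le> q"
  shows "\<exists>K :: int \<Rightarrow> 'k set.
           K 1 = UNIV \<and>
           (\<forall>i\<in>{1..p}. closed (K i)) \<and>
           (\<forall>i\<in>{1..p - 1}. K (i + 1) \<subseteq> K i) \<and>
           K p \<in> ci (UNIV :: 'l set) \<and>
           (\<forall>i\<in>{1..p - 1}. \<forall>x\<in>K i - K (i + 1).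
              \<exists>U. open U \<and> x \<in> U \<and> closure U \<inter> K i \<in> ci (UNIV :: 'l set))"
proof -
  from assms(3) have lin: "linear T" by (simp add: isomorphic_embedding_def)
  interpret positive_operator_compact T
    using assms(1,2,4) lin by (intro positive_operator_compact.intro)
  define I where "I = inverse_onorm T"
  define e :: "'k \<Rightarrow>\<^sub>C real" where "e = const_bcontfun 1"
  have norm_e: "norm e = 1" by (simp add: e_def norm_const_bcontfun_one)
  have bounded: "bounded_linear T"
    using assms(3) lin unfolding isomorphic_embedding_def
    by (auto simp: bounded_linear_def bounded_linear_axioms_def mult.commute)
  have le_I: "norm g \<le> I * norm (T g)" for g
    unfolding I_def by (rule norm_le_inverse_onorm[OF assms(3)])
  have norm_Te: "norm (T e) \<le> onorm T"
    using onorm[OF bounded, of e] norm_e by simp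
  have I_pos: "I > 0"
    using le_I[of e] norm_e by (smt (verit) mult_nonpos_nonneg norm_ge_zero)

  have "1 \<le> onorm T * I"
    using le_I[of e] norm_e mult_left_mono[OF norm_Te, of I] I_pos
    unfolding mult.commute[of "onorm T" I] by linarith
  then have "2 powi p > (2::real) powi 0" using assms(5) by (simp add: I_def)
  then have p: "p \<ge> 1"
    using power_int_increasing[of p 0 "2::real"] by (cases "p \<le> 0") auto
  define n where "n = nat (p - 1)"
  have pn: "2 powi p = (2::real) * 2 ^ n"
  proof -
    have "p = int (Suc n)" using p by (simp add: n_def)
    then show ?thesis by (simp only: power_int_of_nat power_Suc)
  qed

  \<comment> \<open>For a peak function \<open>h\<close> the maximum of \<open>T h \<ge> 0\<close> is its norm, which is at least
    \<open>\<parallel>h\<parallel> / I = 1 / I\<close>.\<close>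
  have cover: "\<exists>y. atom (1 / I) y x" for x
  proof (rule atom_if_peaks, rule ccontr)
    fix h assume h: "peak x h" and "\<nexists>y. 1 / I \<le> T h y"
    then have small: "T h y < 1 / I" for y by (simp add: not_le)
    have "\<exists>y0\<in>UNIV. \<forall>y\<in>UNIV. T h y \<le> T h y0"
      by (intro continuous_attains_sup compact_codomain) auto
    then obtain y0 where y0: "\<And>y. T h y \<le> T h y0" by auto
    have "norm (T h) \<le> T h y0"
      using y0 h positive by (intro norm_bound) (auto simp: positive_operator_def peak_def)
    then have "norm (T h) < 1 / I" using small[of y0] by linarith
    then have "I * norm (T h) < 1" using I_pos by (simp add: field_simps)
    moreover have "1 \<le> norm h"
      using norm_bounded[of h x] h by (simp add: peak_def)
    ultimately show False using le_I[of h] by linarith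
  qed

  have mass: "T (const_bcontfun 1) y < 2 * (2 ^ n * (1 / I))" for y
  proof -
    have "T e y \<le> onorm T"
      using norm_bounded[of "T e" y] norm_Te by simp
    also have "\<dots> < 2 * (2 ^ n * (1 / I))"
      using assms(5) I_pos pn by (simp add: I_def field_simps)
    finally show ?thesis by (simp add: e_def)
  qed

  define K where "K i = (ci_derivative ^^ nat (i - 1)) UNIV" for i :: int
  have K_step: "K (i + 1) = ci_derivative (K i)" if "i \<ge> 1" for i
  proof -
    have "nat (i + 1 - 1) = Suc (nat (i - 1))" using that by simp
    then show ?thesis unfolding K_def by simp
  qed
  have "K p \<in> ci (UNIV :: 'l set)"
    unfolding K_def n_def[symmetric]
    using iterated_derivative_in_ci[OF cover _ mass] I_pos by simp
  moreover have "K 1 = UNIV" "closed (K i)" for i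
    by (simp_all add: K_def closed_iterated_derivative)
  ultimately show ?thesis
    by (intro exI[of _ K]) (auto simp: K_step ci_derivative_def)
qed

end
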